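(* Let $R$ be a unital $*$-ring and let $a,b\in R$ be core invertible with $ab=ba$ and $ab^*=b^*a$. Then $ab$ is core invertible and $(ab)^{(\#)}=b^{(\#)}a^{(\#)}=a^{(\#)}b^{(\#)}$.
   Context: A unital $*$-ring is an associative (not necessarily commutative) ring $R$ with unity $1$ and an involution $a\mapsto a^*$ satisfying $(a^* )^*=a$, $(a+b)^*=a^*+b^*$, $(ab)^*=b^*a^*$ for all $a,b\in R$. An element $a\in R$ is core invertible if there exists $x\in R$ such that $axa=a$, $xR=aR$ and $Rx=Ra^*$; such $x$ is unique if it exists, is called the core inverse of $a$, and is denoted by $a^{(\#)}$. *)

theory Defs
  imports Main
begin

text \<open>The class is built from ring and monoid_mult rather than from ring_1, because ring_1
  assumes 0 \<noteq> 1 and would exclude the zero ring.\<close>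

class unital_star_ring = ring + monoid_mult +
  fixes star :: "'a \<Rightarrow> 'a"
  assumes star_star: "star (star a) = a"
    and star_add: "star (a + b) = star a + star b"
    and star_mult: "star (a * b) = star b * star a"

definition is_core_inverse :: "'a::unital_star_ring \<Rightarrow> 'a \<Rightarrow> bool" where
  "is_core_inverse a x \<longleftrightarrow>
     a * x * a = a \<and>
     {x * r | r. True} = {a * r | r. True} \<and>
     {r * x | r. True} = {r * star a | r. True}"

definition core_invertible :: "'a::unital_star_ring \<Rightarrow> bool" where
  "core_invertible a \<longleftrightarrow> (\<exists>x. is_core_inverse a x)"

text \<open>Only meaningful for core invertible arguments; uniqueness is shown below.\<close>

definition core_inverse :: "'a::unital_star_ring \<Rightarrow> 'a" where
  "core_inverse a = (THE x. is_core_inverse a x)"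

lemma is_core_inverse_equations:
  fixes a x :: "'a::unital_star_ring"
  assumes "is_core_inverse a x"
  shows "a * x * a = a" "star (a * x) = a * x" "x * a * a = a" "a * x * x = x" "x * a * x = x"
proof -
  show axa: "a * x * a = a" using assms by (simp add: is_core_inverse_def)
  have R: "{x * r | r. True} = {a * r | r. True}" and L: "{r * x | r. True} = {r * star a | r. True}"
    using assms by (simp_all add: is_core_inverse_def)
  have "x * 1 \<in> {x * r | r. True}" by blast
  then obtain s where s: "x = a * s" unfolding R by auto
  have "a * 1 \<in> {a * r | r. True}" by blast
  then obtain u where u: "a = x * u" unfolding R[symmetric] by auto
  have "1 * x \<in> {r * x | r. True}" by blast
  then obtain t where t: "x = t * star a" unfolding L by auto
  have "star a = star a * star (a * x)" by (metis axa star_mult)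
  then have x: "x * star (a * x) = x" by (metis t mult.assoc)
  then have "a * x = (a * x) * star (a * x)" by (simp add: mult.assoc)
  then show h: "star (a * x) = a * x" by (metis star_mult star_star)
  show xax: "x * a * x = x" using x unfolding h by (simp add: mult.assoc)
  show "x * a * a = a" by (metis u xax mult.assoc)
  show "a * x * x = x" by (metis s axa mult.assoc)
qed

lemma is_core_inverse_unique:
  fixes a x y :: "'a::unital_star_ring"
  assumes "is_core_inverse a x" "is_core_inverse a y"
  shows "x = y"
proof -
  note X = is_core_inverse_equations[OF assms(1)]
  note Y = is_core_inverse_equations[OF assms(2)]
  have "a * x = (a * y) * (a * x)" using Y(1) by (simp add: mult.assoc[symmetric])
  also have "\<dots> = star ((a * x) * (a * y))" by (simp add: star_mult[of "a * x"] X(2) Y(2))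
  also have "(a * x) * (a * y) = a * y" using X(1) by (simp add: mult.assoc[symmetric])
  finally have e: "a * x = a * y" using Y(2) by simp
  have "y = x * a * a * y * y" using Y(4) X(3) by (simp add: mult.assoc)
  also have "\<dots> = x * a * y" using Y(4) by (simp add: mult.assoc)
  also have "\<dots> = x" using X(5) e by (simp add: mult.assoc)
  finally show ?thesis by simp
qed

lemma core_inverse_eqI:
  fixes a x :: "'a::unital_star_ring"
  shows "is_core_inverse a x \<Longrightarrow> core_inverse a = x"
  unfolding core_inverse_def by (blast intro: is_core_inverse_unique)

end

theory Submission
  imports Defs
begin

text \<open>Write \<open>x\<close> and \<open>y\<close> for the core inverses of \<open>a\<close> and \<open>b\<close>. The core inverse is doubly
  \<open>*\<close>-commuting: whatever commutes with \<open>a\<close> and \<open>star a\<close> commutes with \<open>x\<close>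
  (lemma \<open>core_inverse_commute\<close>). The hypotheses and their adjoints say that \<open>b\<close> and \<open>star b\<close>
  both commute with \<open>a\<close> and \<open>star a\<close>, so both commute with \<open>x\<close>; since \<open>x\<close> then commutes with
  \<open>b\<close> and \<open>star b\<close>, it also commutes with \<open>y\<close>. Hence \<open>a\<close> and \<open>x\<close> commute with \<open>b\<close> and \<open>y\<close>, and
  each of the three equations that characterise \<open>y * x\<close> as core inverse of \<open>a * b\<close>
  (lemma \<open>is_core_inverseI\<close>) splits into a product of the same equations for \<open>(a, x)\<close> and
  \<open>(b, y)\<close>.\<close>

text \<open>Equations are easier to verify for a product than equality of one-sided ideals. Each of the
  four ideal inclusions is witnessed by writing one generator as a multiple of the other:
  \<open>x = a * x * x\<close>, \<open>a = x * a * a\<close>, \<open>x = x * star x * star a\<close> and \<open>star a = star a * a * x\<close>.\<close>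

lemma is_core_inverseI:
  fixes a x :: "'a::unital_star_ring"
  assumes proj: "star (a * x) = a * x" and xaa: "x * a * a = a" and axx: "a * x * x = x"
  shows "is_core_inverse a x"
proof -
  have axa: "a * x * a = a"
  proof -
    have "a * x * a = a * x * x * a * a" using xaa by (simp add: mult.assoc)
    then show ?thesis using axx xaa by simp
  qed
  have xax: "x * a * x = x"
  proof -
    have "x * a * x = x * a * a * x * x" using axx by (simp add: mult.assoc)
    then show ?thesis using axx xaa by simp
  qed
  have x_eq: "x = x * star x * star a"
    using xax proj by (simp add: star_mult mult.assoc)
  have a_eq: "star a = star a * a * x"
  proof -
    have "star a = star (a * x * a)" by (simp only: axa)
    also have "\<dots> = star a * (a * x)" by (simp only: star_mult[of "a * x"] proj)
    finally show ?thesis by (simp add: mult.assoc)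
  qed
  have "{x * r | r. True} = {a * r | r. True}"
  proof (intro equalityI subsetI)
    fix t assume "t \<in> {x * r | r. True}"
    then obtain r where "t = x * r" by blast
    then have "t = a * (x * x * r)" using axx by (simp add: mult.assoc[symmetric])
    then show "t \<in> {a * r | r. True}" by blast
  next
    fix t assume "t \<in> {a * r | r. True}"
    then obtain r where "t = a * r" by blast
    then have "t = x * (a * a * r)" using xaa by (simp add: mult.assoc[symmetric])
    then show "t \<in> {x * r | r. True}" by blast
  qed
  moreover have "{r * x | r. True} = {r * star a | r. True}"
  proof (intro equalityI subsetI)
    fix t assume "t \<in> {r * x | r. True}"
    then obtain r where "t = r * x" by blast
    then have "t = (r * x * star x) * star a" using x_eq by (metis mult.assoc)
    then show "t \<in> {r * star a | r. True}" by blast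
  next
    fix t assume "t \<in> {r * star a | r. True}"
    then obtain r where "t = r * star a" by blast
    then have "t = (r * star a * a) * x" using a_eq by (metis mult.assoc)
    then show "t \<in> {r * x | r. True}" by blast
  qed
  ultimately show ?thesis using axa by (simp add: is_core_inverse_def)
qed

text \<open>The projection \<open>p = a * x\<close> generates the same right ideal as \<open>a\<close>. An element commuting with \<open>a\<close>
  leaves this ideal invariant under left multiplication; if its adjoint does the same, then it
  commutes with \<open>p\<close>. Multiplying \<open>p * d = d * p\<close> by \<open>x\<close> on the left gives
  \<open>x * d = x * a * (d * x)\<close>, and \<open>x * a\<close> fixes \<open>d * x = a * d * x * x\<close> because it fixes \<open>a\<close>.\<close>

lemma core_inverse_commute:
  fixes a x d :: "'a::unital_star_ring"
  assumes ax: "is_core_inverse a x"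
    and da: "d * a = a * d" and das: "d * star a = star a * d"
  shows "d * x = x * d"
proof -
  note X = is_core_inverse_equations[OF ax]
  have invariant: "a * x * e * (a * x) = e * (a * x)" if "e * a = a * e" for e
  proof -
    have "a * x * e * (a * x) = a * x * (e * a) * x" by (simp add: mult.assoc)
    also have "\<dots> = (a * x * a) * e * x" by (simp add: that mult.assoc)
    also have "\<dots> = e * (a * x)" using that by (simp add: X(1) mult.assoc[symmetric])
    finally show ?thesis .
  qed
  have ds: "star d * a = a * star d" using das by (metis star_mult star_star)
  have "a * x * d = star (star d * (a * x))"
    by (simp only: star_mult[of "star d"] X(2) star_star)
  also have "\<dots> = star (a * x * star d * (a * x))" by (simp only: invariant[OF ds])
  also have "\<dots> = a * x * (d * (a * x))"
    by (simp only: star_mult[of "a * x * star d"] star_mult[of "a * x" "star d"] X(2) star_star)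
  also have "\<dots> = d * (a * x)" using invariant[OF da] by (simp only: mult.assoc)
  finally have pd: "a * x * d = d * (a * x)" .
  have "x * d = x * (a * x * d)" using X(5) by (simp add: mult.assoc[symmetric])
  also have "\<dots> = x * (d * a) * x" by (simp only: pd) (simp only: mult.assoc)
  also have "\<dots> = x * a * d * (a * x * x)" by (simp only: da X(4)) (simp only: mult.assoc)
  also have "\<dots> = x * a * (d * a) * x * x" by (simp only: mult.assoc)
  also have "\<dots> = (x * a * a) * d * x * x" by (simp only: da mult.assoc)
  also have "\<dots> = d * (a * x * x)" by (simp add: X(3) da[symmetric] mult.assoc[symmetric])
  also have "\<dots> = d * x" by (simp add: X(4))
  finally show ?thesis by simp
qed

lemma is_core_inverse_mult:
  fixes a b x y :: "'a::unital_star_ring"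
  assumes ax: "is_core_inverse a x" and "is_core_inverse b y"
    and ab: "a * b = b * a" and xb: "x * b = b * x"
    and ay: "a * y = y * a" and xy: "x * y = y * x"
  shows "is_core_inverse (a * b) (y * x)"
proof (rule is_core_inverseI)
  note X = is_core_inverse_equations[OF assms(1)]
  note Y = is_core_inverse_equations[OF assms(2)]
  have "a * b * (y * x) = a * (b * x) * y" by (simp add: xy mult.assoc)
  then have p: "a * b * (y * x) = (a * x) * (b * y)" by (simp add: xb[symmetric] mult.assoc)
  have "(a * x) * (b * y) = a * (b * x) * y" by (simp add: xb[symmetric] mult.assoc)
  also have "\<dots> = (b * a) * (y * x)" by (simp add: ab[symmetric] xy mult.assoc)
  also have "\<dots> = b * (a * y) * x" by (simp only: mult.assoc)
  also have "\<dots> = (b * y) * (a * x)" by (simp only: ay mult.assoc)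
  finally have "(a * x) * (b * y) = (b * y) * (a * x)" .
  then show "star (a * b * (y * x)) = a * b * (y * x)"
    by (simp only: p star_mult[of "b * y"] X(2) Y(2))
  have "y * x * (a * b) * (a * b) = y * (x * a * (b * a)) * b" by (simp only: mult.assoc)
  also have "\<dots> = y * (x * a * a) * b * b" by (simp only: ab[symmetric] mult.assoc)
  also have "\<dots> = a * (y * b * b)" by (simp add: X(3) ay[symmetric] mult.assoc[symmetric])
  finally show "y * x * (a * b) * (a * b) = a * b" by (simp add: Y(3))
  have "a * b * (y * x) * (y * x) = a * b * y * (x * y) * x" by (simp only: mult.assoc)
  also have "\<dots> = a * (b * y * y) * x * x" by (simp only: xy mult.assoc)
  also have "\<dots> = y * (a * x * x)" by (simp add: Y(4) ay mult.assoc[symmetric])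
  finally show "a * b * (y * x) * (y * x) = y * x" by (simp add: X(4))
qed

theorem theorem3p5:
  fixes a b :: "'a::unital_star_ring"
  assumes "core_invertible a" and "core_invertible b"
    and "a * b = b * a" and "a * star b = star b * a"
  shows "core_invertible (a * b) \<and>
    core_inverse (a * b) = core_inverse b * core_inverse a \<and>
    core_inverse b * core_inverse a = core_inverse a * core_inverse b"
proof -
  obtain x y where x: "is_core_inverse a x" and y: "is_core_inverse b y"
    using assms(1,2) by (auto simp: core_invertible_def)
  have adj: "star a * star b = star b * star a" by (metis assms(3) star_mult)
  have adj': "b * star a = star a * b" by (metis assms(4) star_mult star_star)
  have bx: "b * x = x * b"
    by (rule core_inverse_commute[OF x assms(3)[symmetric] adj'])
  have bsx: "star b * x = x * star b"
    by (rule core_inverse_commute[OF x assms(4)[symmetric] adj[symmetric]])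
  have ay: "a * y = y * a"
    by (rule core_inverse_commute[OF y assms(3,4)])
  have xy: "x * y = y * x"
    by (rule core_inverse_commute[OF y bx[symmetric] bsx[symmetric]])
  have "is_core_inverse (a * b) (y * x)"
    by (rule is_core_inverse_mult[OF x y assms(3) bx[symmetric] ay xy])
  then show ?thesis
    using xy core_inverse_eqI[OF x] core_inverse_eqI[OF y]
    by (auto simp: core_invertible_def core_inverse_eqI)
qed

end
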